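(* Let $d,m\ge 1$ be integers, let $P\subset\mathbb{R}^d$ be a $d$-dimensional convex body, let $Q\subset\mathbb{R}^m$ be an $m$-dimensional convex body, and let $\alpha\in[0,d]$ be real. Then $$g_{\alpha+m}(P\times Q)\ge g_\alpha(P),$$ where $P\times Q\subset\mathbb{R}^{d+m}$ is the direct product.
   Context: A convex body in $\mathbb{R}^n$ is a compact convex set with non-empty interior. For a convex body $B\subset\mathbb{R}^n$ and real $\alpha\ge 0$, $$g_\alpha(B)=\inf\left\{\sum_{i=1}^k \lambda_i^\alpha : k\in\mathbb{N},\ B\subseteq \bigcup_{i=1}^k(\lambda_i B+x_i),\ \lambda_i\in(0,1),\ x_i\in\mathbb{R}^n\right\}.$$ *)

theory Defs
  imports "HOL-Analysis.Analysis"
begin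

definition convex_body :: "'a::euclidean_space set \<Rightarrow> bool" where
  "convex_body B \<longleftrightarrow> compact B \<and> convex B \<and> interior B \<noteq> {}"

(* For a convex body the set below is non-empty (by compactness, finitely many translates
   of B/2 cover B) and bounded below by 0, so the real Inf is the genuine infimum.
   All ratios l i are positive, so powr is the ordinary real power, also for \<alpha> = 0. *)
definition g_cover :: "real \<Rightarrow> 'a::euclidean_space set \<Rightarrow> real" where
  "g_cover \<alpha> B =
     Inf {(\<Sum>i<k. l i powr \<alpha>) | (k::nat) (l :: nat \<Rightarrow> real) (x :: nat \<Rightarrow> 'a).
            (\<forall>i<k. 0 < l i \<and> l i < 1) \<and>
            B \<subseteq> (\<Union>i<k. (\<lambda>b. l i *\<^sub>R b + x i) ` B)}"

end

theory Submission imports Defs begin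

text \<open>
  The proof averages over the fibres of \<open>P \<times> Q\<close>. Given a cover of \<open>P \<times> Q\<close> by smaller
  homothets \<open>l\<^sub>i (P \<times> Q) + (x\<^sub>i, y\<^sub>i)\<close>, fix a point \<open>y \<in> Q\<close>. The fibre \<open>P \<times> {y}\<close> meets the
  \<open>i\<close>-th homothet only if \<open>y \<in> l\<^sub>i Q + y\<^sub>i\<close>, and then in a translate of \<open>l\<^sub>i P\<close>. These
  translates cover \<open>P\<close>, so the sum of \<open>l\<^sub>i powr \<alpha>\<close> over all \<open>i\<close> with \<open>y \<in> l\<^sub>i Q + y\<^sub>i\<close> is at
  least \<open>g_cover \<alpha> P\<close> (lemma \<open>g_cover_le_fibre_sum\<close>).

  Integrating this over \<open>y \<in> Q\<close> gives
  \<open>g_cover \<alpha> P * vol Q \<le> (\<Sum>i. l\<^sub>i powr \<alpha> * vol (l\<^sub>i Q + y\<^sub>i))\<close>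
  (lemma \<open>measure_weighted_cover\<close>). Since \<open>vol (l\<^sub>i Q + y\<^sub>i) = l\<^sub>i ^ m * vol Q\<close>, where
  \<open>m\<close> is the dimension of \<open>Q\<close>, and since \<open>vol Q > 0\<close>, division by \<open>vol Q\<close> bounds
  \<open>g_cover \<alpha> P\<close> by \<open>\<Sum>i. l\<^sub>i powr (\<alpha> + m)\<close>, which is the cost of the given cover.
\<close>

text \<open>
  A fibre is covered by a subfamily of the given homothets, so covers indexed by
  arbitrary finite sets have to be compared with the infimum.
\<close>

lemma g_cover_le_finite_cover:
  fixes B :: "'a::euclidean_space set"
  assumes "finite I"
    and ratios: "\<And>i. i \<in> I \<Longrightarrow> 0 < l i \<and> l i < 1"
    and cover: "B \<subseteq> (\<Union>i\<in>I. (\<lambda>b. l i *\<^sub>R b + x i) ` B)"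
  shows "g_cover \<alpha> B \<le> (\<Sum>i\<in>I. l i powr \<alpha>)"
proof -
  obtain h where h: "bij_betw h {..<card I} I"
    using ex_bij_betw_nat_finite[OF \<open>finite I\<close>] by (auto simp: atLeast0LessThan)
  have img: "h ` {..<card I} = I"
    using h by (simp add: bij_betw_def)
  have sum_eq: "(\<Sum>i\<in>I. l i powr \<alpha>) = (\<Sum>j<card I. l (h j) powr \<alpha>)"
    using sum.reindex_bij_betw[OF h, of "\<lambda>i. l i powr \<alpha>"] by simp
  have ratios': "\<forall>j<card I. 0 < l (h j) \<and> l (h j) < 1"
    using ratios img by blast
  have cover': "B \<subseteq> (\<Union>j<card I. (\<lambda>b. l (h j) *\<^sub>R b + x (h j)) ` B)"
    using cover by (subst (asm) img[symmetric]) (simp only: image_image)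
  show ?thesis
    unfolding g_cover_def
  proof (rule cInf_lower)
    show "(\<Sum>i\<in>I. l i powr \<alpha>) \<in> {(\<Sum>i<k. l i powr \<alpha>) | (k::nat) (l :: nat \<Rightarrow> real) (x :: nat \<Rightarrow> 'a).
            (\<forall>i<k. 0 < l i \<and> l i < 1) \<and> B \<subseteq> (\<Union>i<k. (\<lambda>b. l i *\<^sub>R b + x i) ` B)}"
      unfolding mem_Collect_eq
      by (rule exI[of _ "card I"], rule exI[of _ "l \<circ> h"], rule exI[of _ "x \<circ> h"])
         (use sum_eq ratios' cover' in simp)
  qed (auto intro!: bdd_belowI[of _ 0] sum_nonneg)
qed

text \<open>
  The translates of the interior of \<open>B/2\<close> form an open cover of the compact set \<open>B\<close>. This
  makes the infimum defining \<open>g_cover\<close> one over a non-empty set, so that a bound for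
  the cost of every cover bounds \<open>g_cover\<close> itself.
\<close>

lemma convex_body_half_cover:
  fixes B :: "'a::euclidean_space set"
  assumes "convex_body B"
  obtains k :: nat and x :: "nat \<Rightarrow> 'a"
  where "B \<subseteq> (\<Union>i<k. (\<lambda>b. (1/2) *\<^sub>R b + x i) ` B)"
proof -
  define T where "T z = (\<lambda>b. (1/2) *\<^sub>R b + z) ` interior B" for z :: 'a
  have "open (T z)" for z
  proof -
    have "T z = (+) z ` ((\<lambda>b. (1/2) *\<^sub>R b) ` interior B)"
      by (auto simp: T_def image_image add.commute)
    then show ?thesis
      using open_translation open_scaling[of "1/2" "interior B"] by simp
  qed
  obtain c where c: "c \<in> interior B"
    using assms by (auto simp: convex_body_def)
  have "z \<in> T (z - (1/2) *\<^sub>R c)" for z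
    unfolding T_def by (rule image_eqI[OF _ c]) simp
  then have "B \<subseteq> (\<Union>z\<in>UNIV. T z)"
    by blast
  then obtain C where C: "finite C" "B \<subseteq> (\<Union>z\<in>C. T z)"
    using compactE_image[of B UNIV T] assms \<open>\<And>z. open (T z)\<close>
    by (metis convex_body_def)
  obtain k :: nat and x where x: "C = x ` {i. i < k}"
    using finite_imp_nat_seg_image_inj_on[OF C(1)] by blast
  have "T z \<subseteq> (\<lambda>b. (1/2) *\<^sub>R b + z) ` B" for z
    unfolding T_def using interior_subset by blast
  then have "B \<subseteq> (\<Union>i<k. (\<lambda>b. (1/2) *\<^sub>R b + x i) ` B)"
    using C(2) unfolding x by force
  then show thesis
    by (rule that)
qed

lemma g_cover_greatest:
  fixes B :: "'a::euclidean_space set"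
  assumes "convex_body B"
    and bound: "\<And>(k::nat) l x. \<lbrakk>\<And>i. i < k \<Longrightarrow> 0 < l i \<and> l i < 1;
            B \<subseteq> (\<Union>i<k. (\<lambda>b. l i *\<^sub>R b + x i) ` B)\<rbrakk> \<Longrightarrow> c \<le> (\<Sum>i<k. l i powr \<alpha>)"
  shows "c \<le> g_cover \<alpha> B"
proof -
  obtain k :: nat and x where "B \<subseteq> (\<Union>i<k. (\<lambda>b. (1/2) *\<^sub>R b + x i) ` B)"
    using convex_body_half_cover[OF assms(1)] .
  then have half: "\<exists>(k::nat) (l :: nat \<Rightarrow> real) (x :: nat \<Rightarrow> 'a).
      (\<forall>i<k. 0 < l i \<and> l i < 1) \<and> B \<subseteq> (\<Union>i<k. (\<lambda>b. l i *\<^sub>R b + x i) ` B)"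
    by (intro exI[of _ k] exI[of _ "\<lambda>_. 1/2"] exI[of _ x]) simp
  show ?thesis
    unfolding g_cover_def
  proof (rule cInf_greatest)
    fix s
    assume "s \<in> {(\<Sum>i<k. l i powr \<alpha>) | (k::nat) (l :: nat \<Rightarrow> real) (x :: nat \<Rightarrow> 'a).
            (\<forall>i<k. 0 < l i \<and> l i < 1) \<and> B \<subseteq> (\<Union>i<k. (\<lambda>b. l i *\<^sub>R b + x i) ` B)}"
    then show "c \<le> s"
      using bound by auto
  qed (use half in simp)
qed

text \<open>
  A homothet of \<open>P \<times> Q\<close> is the product of homothets of \<open>P\<close> and of \<open>Q\<close> with the same ratio, so
  the homothets that meet the fibre over \<open>y\<close> restrict to a cover of \<open>P\<close> with the same
  ratios.
\<close>

lemma g_cover_le_fibre_sum: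
  fixes P :: "'a::euclidean_space set" and Q :: "'b::euclidean_space set"
  assumes "finite I"
    and ratios: "\<And>i. i \<in> I \<Longrightarrow> 0 < l i \<and> l i < 1"
    and cover: "P \<times> Q \<subseteq> (\<Union>i\<in>I. (\<lambda>b. l i *\<^sub>R b + x i) ` (P \<times> Q))"
    and "y \<in> Q"
  shows "g_cover \<alpha> P \<le> (\<Sum>i\<in>{i \<in> I. y \<in> (\<lambda>q. l i *\<^sub>R q + snd (x i)) ` Q}. l i powr \<alpha>)"
proof (rule g_cover_le_finite_cover)
  show "P \<subseteq> (\<Union>i\<in>{i \<in> I. y \<in> (\<lambda>q. l i *\<^sub>R q + snd (x i)) ` Q}.
              (\<lambda>p. l i *\<^sub>R p + fst (x i)) ` P)"
  proof
    fix p assume "p \<in> P"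
    then obtain i p' q' where "i \<in> I" "p' \<in> P" "q' \<in> Q"
      and eq: "(p, y) = l i *\<^sub>R (p', q') + x i"
      using cover \<open>y \<in> Q\<close> by blast
    moreover have "p = l i *\<^sub>R p' + fst (x i)" "y = l i *\<^sub>R q' + snd (x i)"
      using arg_cong[OF eq, of fst] arg_cong[OF eq, of snd] by simp_all
    ultimately show "p \<in> (\<Union>i\<in>{i \<in> I. y \<in> (\<lambda>q. l i *\<^sub>R q + snd (x i)) ` Q}.
              (\<lambda>p. l i *\<^sub>R p + fst (x i)) ` P)"
      by blast
  qed
qed (use assms in auto)

text \<open>
  Integrate the pointwise bound \<open>c * indicator Q \<le> (\<Sum>i. w\<^sub>i * indicator S\<^sub>i)\<close>; off \<open>Q\<close> it holds
  because the weights are non-negative.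
\<close>

lemma measure_weighted_cover:
  fixes w :: "'i \<Rightarrow> real"
  assumes "finite I" and Q: "Q \<in> fmeasurable M"
    and S: "\<And>i. i \<in> I \<Longrightarrow> S i \<in> fmeasurable M"
    and w: "\<And>i. i \<in> I \<Longrightarrow> 0 \<le> w i"
    and bound: "\<And>y. y \<in> Q \<Longrightarrow> c \<le> (\<Sum>i\<in>{i \<in> I. y \<in> S i}. w i)"
  shows "c * measure M Q \<le> (\<Sum>i\<in>I. w i * measure M (S i))"
proof -
  have int: "integrable M (\<lambda>y. a * indicator A y)" if "A \<in> fmeasurable M" for A and a :: real
    using that by (intro integrable_mult_right) (auto simp: fmeasurable_def)
  have meas: "(\<integral>y. a * indicator A y \<partial>M) = a * measure M A"
    if "A \<in> fmeasurable M" for A and a :: real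
    using sets.sets_into_space[OF fmeasurableD[OF that]] by (simp add: Int_absorb2)
  have "c * indicator Q y \<le> (\<Sum>i\<in>I. w i * indicator (S i) y)" for y
  proof (cases "y \<in> Q")
    case True
    have "(\<Sum>i\<in>I. w i * indicator (S i) y) = (\<Sum>i\<in>{i \<in> I. y \<in> S i}. w i)"
      using \<open>finite I\<close> by (intro sum.mono_neutral_cong_right) auto
    then show ?thesis
      using bound[OF True] True by simp
  qed (simp add: w sum_nonneg)
  then have "(\<integral>y. c * indicator Q y \<partial>M) \<le> (\<integral>y. (\<Sum>i\<in>I. w i * indicator (S i) y) \<partial>M)"
    by (intro integral_mono Bochner_Integration.integrable_sum int Q S)
  also have "\<dots> = (\<Sum>i\<in>I. \<integral>y. w i * indicator (S i) y \<partial>M)"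
    by (intro Bochner_Integration.integral_sum int S)
  also have "\<dots> = (\<Sum>i\<in>I. w i * measure M (S i))"
    by (intro sum.cong refl meas S)
  finally show ?thesis
    by (simp only: meas[OF Q])
qed

lemma convex_body_Times:
  assumes "convex_body P" and "convex_body Q"
  shows "convex_body (P \<times> Q)"
  using assms by (auto simp: convex_body_def compact_Times convex_Times interior_Times)

lemma convex_body_measure_pos:
  assumes "convex_body Q"
  shows "0 < measure lebesgue Q"
proof -
  have "\<not> negligible Q" "Q \<in> lmeasurable"
    using assms by (auto simp: convex_body_def negligible_convex_interior lmeasurable_compact)
  then have "measure lebesgue Q \<noteq> 0"
    by (simp add: negligible_iff_measure0)
  then show ?thesis
    by (simp add: zero_less_measure_iff)
qed

theorem proposition1:
  fixes P :: "'a::euclidean_space set"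
    and Q :: "'b::euclidean_space set"
    and \<alpha> :: real
  assumes "convex_body P"
    and "convex_body Q"
    and "0 \<le> \<alpha>" and "\<alpha> \<le> real DIM('a)"
  shows "g_cover (\<alpha> + real DIM('b)) (P \<times> Q) \<ge> g_cover \<alpha> P"
proof (rule g_cover_greatest[OF convex_body_Times[OF assms(1,2)]])
  fix k :: nat and l :: "nat \<Rightarrow> real" and x :: "nat \<Rightarrow> 'a \<times> 'b"
  assume ratios: "\<And>i. i < k \<Longrightarrow> 0 < l i \<and> l i < 1"
    and cover: "P \<times> Q \<subseteq> (\<Union>i<k. (\<lambda>b. l i *\<^sub>R b + x i) ` (P \<times> Q))"
  define S where "S i = (\<lambda>q. l i *\<^sub>R q + snd (x i)) ` Q" for i
  have "compact Q"
    using assms(2) by (simp add: convex_body_def)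
  have "compact (S i)" for i
    unfolding S_def by (intro compact_continuous_image \<open>compact Q\<close> continuous_intros)
  have "g_cover \<alpha> P * measure lebesgue Q \<le> (\<Sum>i<k. l i powr \<alpha> * measure lebesgue (S i))"
  proof (rule measure_weighted_cover)
    show "g_cover \<alpha> P \<le> (\<Sum>i\<in>{i \<in> {..<k}. y \<in> S i}. l i powr \<alpha>)" if "y \<in> Q" for y
      unfolding S_def by (rule g_cover_le_fibre_sum) (use ratios cover that in auto)
  qed (simp_all add: lmeasurable_compact \<open>compact Q\<close> \<open>\<And>i. compact (S i)\<close>)
  also have "\<dots> = (\<Sum>i<k. l i powr (\<alpha> + real DIM('b)) * measure lebesgue Q)"
  proof (rule sum.cong)
    fix i assume "i \<in> {..<k}"
    then have "0 < l i"
      using ratios by simp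
    then show "l i powr \<alpha> * measure lebesgue (S i) =
        l i powr (\<alpha> + real DIM('b)) * measure lebesgue Q"
      by (simp add: S_def measure_lebesgue_affine powr_add powr_realpow)
  qed simp
  also have "\<dots> = (\<Sum>i<k. l i powr (\<alpha> + real DIM('b))) * measure lebesgue Q"
    by (simp add: sum_distrib_right)
  finally show "g_cover \<alpha> P \<le> (\<Sum>i<k. l i powr (\<alpha> + real DIM('b)))"
    using convex_body_measure_pos[OF assms(2)] by simp
qed

end
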